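(* No non-negative integer of the form $4k+3$ ($k\in\mathbb{N}_0$) can be represented in the form $12t_l+g_m+g_n$ with $l,m,n\in\mathbb{Z}$.
   Context: $\mathbb{N}_0=\{0,1,2,\dots\}$. $t_n=n(n+1)/2$ (triangular numbers) and $g_n=n(3n+2)$ (generalized octagonal numbers), $n\in\mathbb{Z}$. *)

theory Defs
  imports Main
begin

definition triangular :: "int \<Rightarrow> int"
  where "triangular n = n * (n + 1) div 2"

definition gen_octagonal :: "int \<Rightarrow> int"
  where "gen_octagonal n = n * (3 * n + 2)"

end

theory Submission
  imports Defs
begin

text \<open>Work modulo 4: the term with coefficient 12 vanishes, and
  \<open>gen_octagonal_mod_4\<close> makes each octagonal term 0 or 1, by the parity of its index.
  The sum is thus 0, 1 or 2, never 3.\<close>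

lemma gen_octagonal_mod_4: "gen_octagonal n mod 4 = n mod 2"
proof (cases "even n")
  case True
  then obtain q where "n = 2 * q" by blast
  then have "gen_octagonal n = 4 * (q * (3 * q + 1))"
    by (simp add: gen_octagonal_def algebra_simps)
  with True show ?thesis by simp
next
  case False
  then obtain q where "n = 2 * q + 1" by (rule oddE)
  then have "gen_octagonal n = 1 + 4 * (3 * q * q + 4 * q + 1)"
    by (simp add: gen_octagonal_def algebra_simps)
  with False show ?thesis by (simp only: mod_mult_self2 odd_iff_mod_2_eq_one) simp
qed

theorem corollary5p11p1:
  fixes k :: nat
  shows "\<not> (\<exists>l m n :: int.
    4 * int k + 3 = 12 * triangular l + gen_octagonal m + gen_octagonal n)"
proof
  assume "\<exists>l m n :: int.
    4 * int k + 3 = 12 * triangular l + gen_octagonal m + gen_octagonal n"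
  then obtain l m n where
    "4 * int k + 3 = 12 * triangular l + gen_octagonal m + gen_octagonal n" by blast
  \<comment> \<open>The values of \<open>triangular\<close> and \<open>gen_octagonal\<close> enter
    as integer atoms, which makes the goal linear: \<open>m mod 2 + n mod 2\<close> would have to be
    3 modulo 4.\<close>
  with gen_octagonal_mod_4 [of m] gen_octagonal_mod_4 [of n] show False by presburger
qed

end
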